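(* Let $\mathcal{H}$ be a finite dimensional complex Hilbert space, $\Gamma$ a set, and $\{\rho(\theta),\theta\in\Gamma\}$ a parametric family of states in $\mathcal{H}$. Let $f_1,\dots,f_m:\Gamma\to\mathbb{R}$, let $\mathcal{L}=(S,L)$ be a generalized measurement in $\mathcal{H}$, and let $\varphi_1,\dots,\varphi_m:S\to\mathbb{R}$ be functions such that $(\mathcal{L},\varphi_i)$ is an unbiased estimator of $f_i$ for each $1\le i\le m$. Let $\{F_j, 1\le j\le n\}$ be any set of Fisher maps for $\{\rho(\theta),\theta\in\Gamma\}$. For $\theta\in\Gamma$ let $\Lambda(\theta)$ be the real $m\times n$ matrix with entries $\lambda(f_i,F_j)(\theta)$, where $\lambda$ is the Cramér-Rao-Bhattacharya tensor, and let $\mathcal{I}_n^{-}(\theta)$ be the generalized inverse of the Fisher information matrix $\mathcal{I}_n(\theta)=\left(\mathcal{I}(F_p,F_q)(\theta)\right)_{p,q\in\{1,\dots,n\}}$. Then for every $\theta\in\Gamma$, $$\mathrm{Cov}(\mathcal{L},\varphi_1,\varphi_2,\dots,\varphi_m|\theta)\ \geqslant\ \Lambda(\theta)\,\mathcal{I}_n^{-}(\theta)\,\Lambda(\theta)^{\prime}.$$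
   Context: $\mathcal{B}(\mathcal{H})$ is the algebra of all operators on $\mathcal{H}$, $\dagger$ denotes adjoint, and prime $'$ denotes matrix transpose. An observable is a hermitian operator on $\mathcal{H}$; a state is a nonnegative definite operator on $\mathcal{H}$ of trace one. A parametric family of states is a map $\theta\mapsto\rho(\theta)$ from the set $\Gamma$ to the states. For real symmetric matrices, $A\geqslant B$ means $A-B$ is positive semidefinite. Generalized measurements. A generalized measurement is a pair $\mathcal{L}=(S,L)$ with $S$ a finite set and $L:S\to\mathcal{B}(\mathcal{H})$ satisfying $\sum_{s\in S}L(s)^\dagger L(s)=I$. For $\varphi:S\to\mathbb{R}$, the pair $(\mathcal{L},\varphi)$ is an unbiased estimator of $f:\Gamma\to\mathbb{R}$ if $\sum_{s\in S}\varphi(s)\,\mathrm{Tr}\,\rho(\theta)L(s)^\dagger L(s)=f(\theta)$ for all $\theta\in\Gamma$. If $(\mathcal{L},\varphi_i)$ is an unbiased estimator of $f_i$ for $1\le i\le m$, then $\mathrm{Cov}(\mathcal{L},\varphi_1,\dots,\varphi_m|\theta)$ is the real symmetric $m\times m$ matrix with $(i,j)$ entry $$\mathrm{Tr}\,\rho(\theta)\sum_{s\in S}\varphi_i(s)\varphi_j(s)L(s)^\dagger L(s)-f_i(\theta)f_j(\theta).$$ Observables as estimators. An observable $X$ is an unbiased estimator of $f:\Gamma\to\mathbb{R}$ if $\mathrm{Tr}\,\rho(\theta)X=f(\theta)$ for all $\theta\in\Gamma$; $f$ is estimable if such an $X$ exists. If $(\mathcal{L},\varphi)$ is an unbiased estimator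 of $f$, then $X=\sum_{s\in S}\varphi(s)L(s)^\dagger L(s)$ is an observable that is an unbiased estimator of $f$, so $f$ is estimable. An observable $X$ is balanced if $\mathrm{Tr}\,\rho(\theta)X=0$ for all $\theta\in\Gamma$; $\mathcal{N}$ is the real linear space of balanced observables. Fisher maps. A map $F:\Gamma\to\mathcal{B}(\mathcal{H})$ is a Fisher map if (i) $\mathrm{Tr}\,\rho(\theta)F(\theta)=0$ for all $\theta\in\Gamma$, and (ii) $\mathrm{Tr}\,\rho(\theta)\{F(\theta)^\dagger X+XF(\theta)\}=0$ for all $\theta\in\Gamma$ and all $X\in\mathcal{N}$. Fisher information form. For Fisher maps $F,G$, $\mathcal{I}(F,G)(\theta)=\mathrm{Re}\,\mathrm{Tr}\,\rho(\theta)F(\theta)^\dagger G(\theta)$. Cramér-Rao-Bhattacharya tensor. For $f$ estimable and $F$ a Fisher map, $\lambda(f,F)(\theta)=\frac12\mathrm{Tr}\,\rho(\theta)\left(F(\theta)^\dagger X+XF(\theta)\right)$, where $X$ is any observable that is an unbiased estimator of $f$; by (ii) this does not depend on the choice of $X$. $A^{-}$ denotes the generalized (Moore-Penrose) inverse of a matrix $A$. *)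

theory Defs
  imports "HOL-Analysis.Analysis"
begin

section \<open>Finite dimensional complex Hilbert spaces and their operators\<close>

text \<open>The inner product is conjugate linear in the first argument. Completeness is automatic in
  finite dimension.\<close>

class fd_chilbert = ab_group_add +
  fixes scaleC :: "complex \<Rightarrow> 'a \<Rightarrow> 'a" (infixr "*\<^sub>C" 75)
    and cinner :: "'a \<Rightarrow> 'a \<Rightarrow> complex"
  assumes scaleC_add_right: "c *\<^sub>C (x + y) = c *\<^sub>C x + c *\<^sub>C y"
    and scaleC_add_left: "(c + d) *\<^sub>C x = c *\<^sub>C x + d *\<^sub>C x"
    and scaleC_scaleC: "c *\<^sub>C d *\<^sub>C x = (c * d) *\<^sub>C x"
    and scaleC_one: "1 *\<^sub>C x = x"
    and finite_dim: "\<exists>B. finite B \<and> (\<forall>x. \<exists>c. x = (\<Sum>b\<in>B. c b *\<^sub>C b))"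
    and cinner_commute: "cinner x y = cnj (cinner y x)"
    and cinner_add_right: "cinner x (y + z) = cinner x y + cinner x z"
    and cinner_scaleC_right: "cinner x (c *\<^sub>C y) = c * cinner x y"
    and cinner_ge_zero: "0 \<le> Re (cinner x x)"
    and cinner_eq_zero: "cinner x x = 0 \<Longrightarrow> x = 0"

lemma vector_space_scaleC: "vector_space (scaleC :: complex \<Rightarrow> 'h::fd_chilbert \<Rightarrow> 'h)"
  by unfold_locales (simp_all add: scaleC_add_right scaleC_add_left scaleC_scaleC scaleC_one)

text \<open>Elements of \<open>B(H)\<close> are functions satisfying \<open>is_op\<close>; the operator product is \<open>(\<circ>)\<close>.\<close>

definition is_op :: "('h::fd_chilbert \<Rightarrow> 'h) \<Rightarrow> bool" where
  "is_op A \<longleftrightarrow> Vector_Spaces.linear scaleC scaleC A"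

definition adj :: "('h::fd_chilbert \<Rightarrow> 'h) \<Rightarrow> 'h \<Rightarrow> 'h" ("_\<^sup>\<dagger>" [1000] 1000) where
  "A\<^sup>\<dagger> = (THE B. \<forall>x y. cinner (B x) y = cinner x (A y))"

definition orthonormal_basis :: "'h::fd_chilbert set \<Rightarrow> bool" where
  "orthonormal_basis B \<longleftrightarrow> finite B \<and> module.span scaleC B = UNIV \<and>
     (\<forall>x\<in>B. \<forall>y\<in>B. cinner x y = (if x = y then 1 else 0))"

text \<open>The trace does not depend on the chosen orthonormal basis.\<close>

definition Tr :: "('h::fd_chilbert \<Rightarrow> 'h) \<Rightarrow> complex" where
  "Tr A = (\<Sum>b\<in>(SOME B. orthonormal_basis B). cinner b (A b))"

definition observable :: "('h::fd_chilbert \<Rightarrow> 'h) \<Rightarrow> bool" where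
  "observable X \<longleftrightarrow> is_op X \<and> X\<^sup>\<dagger> = X"

definition state :: "('h::fd_chilbert \<Rightarrow> 'h) \<Rightarrow> bool" where
  "state R \<longleftrightarrow> is_op R \<and> R\<^sup>\<dagger> = R \<and> (\<forall>x. 0 \<le> Re (cinner x (R x))) \<and> Tr R = 1"

definition parametric_family :: "'g set \<Rightarrow> ('g \<Rightarrow> 'h::fd_chilbert \<Rightarrow> 'h) \<Rightarrow> bool" where
  "parametric_family \<Gamma> \<rho> \<longleftrightarrow> (\<forall>\<theta>\<in>\<Gamma>. state (\<rho> \<theta>))"


section \<open>Estimators\<close>

definition generalized_measurement :: "'s set \<Rightarrow> ('s \<Rightarrow> 'h::fd_chilbert \<Rightarrow> 'h) \<Rightarrow> bool" where
  "generalized_measurement S L \<longleftrightarrow> finite S \<and> (\<forall>s\<in>S. is_op (L s)) \<and>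
     (\<forall>x. (\<Sum>s\<in>S. ((L s)\<^sup>\<dagger> \<circ> L s) x) = x)"

definition unbiased_estimator ::
    "'g set \<Rightarrow> ('g \<Rightarrow> 'h::fd_chilbert \<Rightarrow> 'h) \<Rightarrow> 's set \<Rightarrow> ('s \<Rightarrow> 'h \<Rightarrow> 'h) \<Rightarrow>
     ('s \<Rightarrow> real) \<Rightarrow> ('g \<Rightarrow> real) \<Rightarrow> bool" where
  "unbiased_estimator \<Gamma> \<rho> S L \<phi> f \<longleftrightarrow>
     (\<forall>\<theta>\<in>\<Gamma>. (\<Sum>s\<in>S. complex_of_real (\<phi> s) * Tr (\<rho> \<theta> \<circ> (L s)\<^sup>\<dagger> \<circ> L s)) = complex_of_real (f \<theta>))"

text \<open>The traces in \<open>Cov\<close> and in \<open>crb_tensor\<close> below are real numbers; \<open>Re\<close> only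
  serves to give them type \<open>real\<close>.\<close>

definition Cov ::
    "('g \<Rightarrow> 'h::fd_chilbert \<Rightarrow> 'h) \<Rightarrow> 's set \<Rightarrow> ('s \<Rightarrow> 'h \<Rightarrow> 'h) \<Rightarrow>
     ('m \<Rightarrow> 's \<Rightarrow> real) \<Rightarrow> ('m \<Rightarrow> 'g \<Rightarrow> real) \<Rightarrow> 'g \<Rightarrow> real^'m^'m" where
  "Cov \<rho> S L \<phi> f \<theta> = (\<chi> i j.
     Re (Tr (\<rho> \<theta> \<circ> (\<lambda>x. \<Sum>s\<in>S. complex_of_real (\<phi> i s * \<phi> j s) *\<^sub>C ((L s)\<^sup>\<dagger> \<circ> L s) x)))
       - f i \<theta> * f j \<theta>)"

definition unbiased_observable ::
    "'g set \<Rightarrow> ('g \<Rightarrow> 'h::fd_chilbert \<Rightarrow> 'h) \<Rightarrow> ('h \<Rightarrow> 'h) \<Rightarrow> ('g \<Rightarrow> real) \<Rightarrow> bool" where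
  "unbiased_observable \<Gamma> \<rho> X f \<longleftrightarrow>
     observable X \<and> (\<forall>\<theta>\<in>\<Gamma>. Tr (\<rho> \<theta> \<circ> X) = complex_of_real (f \<theta>))"

definition balanced :: "'g set \<Rightarrow> ('g \<Rightarrow> 'h::fd_chilbert \<Rightarrow> 'h) \<Rightarrow> ('h \<Rightarrow> 'h) \<Rightarrow> bool" where
  "balanced \<Gamma> \<rho> X \<longleftrightarrow> observable X \<and> (\<forall>\<theta>\<in>\<Gamma>. Tr (\<rho> \<theta> \<circ> X) = 0)"


section \<open>Fisher maps\<close>

definition fisher_map ::
    "'g set \<Rightarrow> ('g \<Rightarrow> 'h::fd_chilbert \<Rightarrow> 'h) \<Rightarrow> ('g \<Rightarrow> 'h \<Rightarrow> 'h) \<Rightarrow> bool" where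
  "fisher_map \<Gamma> \<rho> F \<longleftrightarrow>
     (\<forall>\<theta>\<in>\<Gamma>. is_op (F \<theta>)) \<and>
     (\<forall>\<theta>\<in>\<Gamma>. Tr (\<rho> \<theta> \<circ> F \<theta>) = 0) \<and>
     (\<forall>\<theta>\<in>\<Gamma>. \<forall>X. balanced \<Gamma> \<rho> X \<longrightarrow>
        Tr (\<rho> \<theta> \<circ> (\<lambda>x. ((F \<theta>)\<^sup>\<dagger> \<circ> X) x + (X \<circ> F \<theta>) x)) = 0)"

definition fisher_form ::
    "('g \<Rightarrow> 'h::fd_chilbert \<Rightarrow> 'h) \<Rightarrow> ('g \<Rightarrow> 'h \<Rightarrow> 'h) \<Rightarrow> ('g \<Rightarrow> 'h \<Rightarrow> 'h) \<Rightarrow> 'g \<Rightarrow> real" where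
  "fisher_form \<rho> F G \<theta> = Re (Tr (\<rho> \<theta> \<circ> (F \<theta>)\<^sup>\<dagger> \<circ> G \<theta>))"

definition fisher_matrix ::
    "('g \<Rightarrow> 'h::fd_chilbert \<Rightarrow> 'h) \<Rightarrow> ('n \<Rightarrow> 'g \<Rightarrow> 'h \<Rightarrow> 'h) \<Rightarrow> 'g \<Rightarrow> real^'n^'n" where
  "fisher_matrix \<rho> F \<theta> = (\<chi> p q. fisher_form \<rho> (F p) (F q) \<theta>)"

text \<open>Meaningful for estimable \<open>f\<close> and a Fisher map \<open>F\<close>; the value is then independent of the
  chosen unbiased observable.\<close>

definition crb_tensor ::
    "'g set \<Rightarrow> ('g \<Rightarrow> 'h::fd_chilbert \<Rightarrow> 'h) \<Rightarrow> ('g \<Rightarrow> real) \<Rightarrow> ('g \<Rightarrow> 'h \<Rightarrow> 'h) \<Rightarrow> 'g \<Rightarrow> real" where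
  "crb_tensor \<Gamma> \<rho> f F \<theta> =
     (let X = (SOME X. unbiased_observable \<Gamma> \<rho> X f)
      in (1/2) * Re (Tr (\<rho> \<theta> \<circ> (\<lambda>x. ((F \<theta>)\<^sup>\<dagger> \<circ> X) x + (X \<circ> F \<theta>) x))))"

definition crb_matrix ::
    "'g set \<Rightarrow> ('g \<Rightarrow> 'h::fd_chilbert \<Rightarrow> 'h) \<Rightarrow> ('m \<Rightarrow> 'g \<Rightarrow> real) \<Rightarrow>
     ('n \<Rightarrow> 'g \<Rightarrow> 'h \<Rightarrow> 'h) \<Rightarrow> 'g \<Rightarrow> real^'n^'m" where
  "crb_matrix \<Gamma> \<rho> f F \<theta> = (\<chi> i j. crb_tensor \<Gamma> \<rho> (f i) (F j) \<theta>)"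


section \<open>Real matrices\<close>

text \<open>The Moore-Penrose inverse is the unique solution of the four Penrose equations.\<close>

definition pinv :: "real^'n^'m \<Rightarrow> real^'m^'n" where
  "pinv A = (THE B. A ** B ** A = A \<and> B ** A ** B = B \<and>
     transpose (A ** B) = A ** B \<and> transpose (B ** A) = B ** A)"

definition mat_ge :: "real^'m^'m \<Rightarrow> real^'m^'m \<Rightarrow> bool" (infix "\<succeq>" 50) where
  "A \<succeq> B \<longleftrightarrow> transpose (A - B) = A - B \<and> (\<forall>x. 0 \<le> x \<bullet> ((A - B) *v x))"

end

theory Submission
  imports Defs
begin

section \<open>The inner product and orthonormal bases\<close>

text \<open>Fix \<theta> and put M s = L(s)\<dagger> L(s). For a real vector u let \<psi> be the
  combination of the functions \<phi> i with weights u, so that u . Cov u is the variance of \<psi>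
  under the outcome probabilities Tr \<rho> M s (\<open>Cov_quadratic_form\<close>). For a real
  vector w let G be the combination of the operators F j \<theta> with weights w, so that w . J w =
  Re Tr \<rho> G\<dagger> G for the Fisher matrix J (\<open>fisher_matrix_quadratic_form\<close>).

  Let c be the mean of \<psi>. Positivity of Tr \<rho> K\<dagger> K for K = L(s) (c - \<psi> s + G),
  summed over the outcomes s, gives 2 (u . \<Lambda> w) - w . J w \<le> u . Cov u
  (\<open>measurement_variance_bound\<close>). Two facts turn the cross terms into u . \<Lambda> w.
  The operators M s add up to the identity and Tr \<rho> G = 0, so the constant c drops out. What
  remains involves the observable X, the sum of \<psi> s M s, and condition (ii) on Fisher maps
  allows \<lambda> to be evaluated at such observables (\<open>crb_tensor_eq\<close>,
  \<open>crb_matrix_bilinear_form\<close>).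

  The inequality holds for every w. With P the Moore-Penrose inverse of J and w = P \<Lambda>' u,
  the identities P' = P and P J P = P (\<open>pinv_symmetric\<close>) give w . J w = u . \<Lambda>
  w, and the left side becomes u . \<Lambda> P \<Lambda>' u.

  The adjoint, the trace and the Moore-Penrose inverse are defined by description or choice
  operators, so existence of adjoints, of orthonormal bases and of Penrose inverses of symmetric
  matrices has to be established as well.\<close>

lemma cinner_add_left: "cinner (x + y) z = cinner x z + cinner y z"
  for x y z :: "'h::fd_chilbert"
  by (metis cinner_add_right cinner_commute complex_cnj_add)

lemma cinner_scaleC_left: "cinner (c *\<^sub>C x) y = cnj c * cinner x y"
  for x y :: "'h::fd_chilbert"
  by (metis cinner_commute cinner_scaleC_right complex_cnj_mult)

lemma cinner_zero_right [simp]: "cinner x 0 = 0" for x :: "'h::fd_chilbert"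
  using cinner_add_right[of x 0 0] by simp

lemma cinner_zero_left [simp]: "cinner 0 x = 0" for x :: "'h::fd_chilbert"
  using cinner_add_left[of 0 0 x] by simp

lemma cinner_diff_right: "cinner x (y - z) = cinner x y - cinner x z"
  for x y z :: "'h::fd_chilbert"
  using cinner_add_right[of x "y - z" z] by simp

lemma cinner_diff_left: "cinner (x - y) z = cinner x z - cinner y z"
  for x y z :: "'h::fd_chilbert"
  using cinner_add_left[of "x - y" y z] by simp

lemma cinner_sum_right: "cinner x (\<Sum>i\<in>I. g i) = (\<Sum>i\<in>I. cinner x (g i))"
  for x :: "'h::fd_chilbert"
  by (induction I rule: infinite_finite_induct) (auto simp: cinner_add_right)

lemma cinner_sum_left: "cinner (\<Sum>i\<in>I. g i) x = (\<Sum>i\<in>I. cinner (g i) x)"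
  for x :: "'h::fd_chilbert"
  by (induction I rule: infinite_finite_induct) (auto simp: cinner_add_left)

lemma scaleC_zero_right [simp]: "c *\<^sub>C (0 :: 'h::fd_chilbert) = 0"
  using scaleC_add_right[of c "0 :: 'h" 0] by simp

lemma scaleC_sum_right: "c *\<^sub>C (\<Sum>i\<in>I. g i) = (\<Sum>i\<in>I. c *\<^sub>C (g i :: 'h::fd_chilbert))"
  by (induction I rule: infinite_finite_induct) (auto simp: scaleC_add_right)

lemma scaleC_zero_left [simp]: "0 *\<^sub>C x = 0" for x :: "'h::fd_chilbert"
  using scaleC_add_left[of 0 0 x] by simp

lemma scaleC_sum_left: "(\<Sum>i\<in>I. a i) *\<^sub>C x = (\<Sum>i\<in>I. a i *\<^sub>C x)"
  for x :: "'h::fd_chilbert"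
  by (induction I rule: infinite_finite_induct) (auto simp: scaleC_add_left)

lemma cinner_ext:
  fixes x y :: "'h::fd_chilbert"
  assumes "\<And>z. cinner x z = cinner y z"
  shows "x = y"
proof -
  have "cinner (x - y) (x - y) = 0"
    using assms by (simp add: cinner_diff_left)
  then show ?thesis
    using cinner_eq_zero[of "x - y"] by simp
qed

section \<open>Gram-Schmidt and the existence of orthonormal bases\<close>

lemma normalize_ex:
  fixes r :: "'h::fd_chilbert"
  assumes "r \<noteq> 0"
  obtains k where "k \<noteq> 0" "cinner (k *\<^sub>C r) (k *\<^sub>C r) = 1"
proof -
  have im: "Im (cinner r r) = 0"
    using arg_cong[OF cinner_commute[of r r], of Im] by simp
  have "Re (cinner r r) \<noteq> 0"
    using cinner_eq_zero[of r] assms im by (auto simp: complex_eq_iff)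
  then have pos: "Re (cinner r r) > 0"
    using cinner_ge_zero[of r] by simp
  define k where "k = complex_of_real (1 / sqrt (Re (cinner r r)))"
  have real: "cinner r r = complex_of_real (Re (cinner r r))"
    using im by (simp add: complex_eq_iff)
  have "cinner (k *\<^sub>C r) (k *\<^sub>C r)
      = complex_of_real ((1 / sqrt (Re (cinner r r)))\<^sup>2 * Re (cinner r r))"
    by (subst cinner_scaleC_left, subst cinner_scaleC_right, subst real)
       (simp only: k_def complex_cnj_complex_of_real of_real_mult power2_eq_square mult.assoc)
  also have "\<dots> = 1"
    using pos by (simp add: power_divide)
  finally show ?thesis
    using that[of k] pos by (simp add: k_def)
qed

text \<open>Each new vector \<open>b\<close> is replaced by its residue \<open>r\<close> after
  projection onto the span of the system built so far. A zero residue means that \<open>b\<close> is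
  already in that span; otherwise the normalized residue joins the system.\<close>

lemma gram_schmidt:
  fixes B :: "'h::fd_chilbert set"
  assumes "finite B"
  shows "\<exists>E. finite E \<and> B \<subseteq> module.span scaleC E \<and>
    (\<forall>x\<in>E. \<forall>y\<in>E. cinner x y = (if x = y then 1 else 0))"
  using assms
proof (induction B rule: finite_induct)
  case empty
  show ?case by (rule exI[of _ "{}"]) simp
next
  case (insert b B)
  interpret V: vector_space "scaleC :: complex \<Rightarrow> 'h \<Rightarrow> 'h" by (rule vector_space_scaleC)
  obtain E where E: "finite E" "B \<subseteq> V.span E"
      "\<And>x y. x \<in> E \<Longrightarrow> y \<in> E \<Longrightarrow> cinner x y = (if x = y then 1 else 0)"
    using insert.IH by blast
  define p where "p = (\<Sum>e\<in>E. cinner e b *\<^sub>C e)"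
  define r where "r = b - p"
  have p: "p \<in> V.span E"
    unfolding p_def by (intro V.span_sum V.span_scale V.span_base)
  have perp: "cinner e r = 0" if "e \<in> E" for e
  proof -
    have "cinner e p = (\<Sum>x\<in>E. cinner x b * (if e = x then 1 else 0))"
      unfolding p_def cinner_sum_right
      by (rule sum.cong) (auto simp: cinner_scaleC_right E(3) that)
    also have "\<dots> = cinner e b"
      using E(1) that by (simp add: if_distrib cong: if_cong)
    finally show ?thesis by (simp add: r_def cinner_diff_right)
  qed
  then have perp': "cinner r e = 0" if "e \<in> E" for e
    using that by (metis cinner_commute complex_cnj_zero)
  show ?case
  proof (cases "r = 0")
    case True
    then have "b \<in> V.span E" using p by (simp add: r_def)
    then show ?thesis using E by blast
  next
    case False
    then obtain k where k: "k \<noteq> 0" "cinner (k *\<^sub>C r) (k *\<^sub>C r) = 1"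
      by (rule normalize_ex)
    let ?E = "insert (k *\<^sub>C r) E"
    have "(1/k) *\<^sub>C (k *\<^sub>C r) \<in> V.span ?E"
      by (intro V.span_scale V.span_base) simp
    then have "r \<in> V.span ?E"
      using k(1) by (simp add: scaleC_scaleC scaleC_one)
    moreover have "p \<in> V.span ?E"
      using p V.span_mono[of E ?E] by auto
    ultimately have "r + p \<in> V.span ?E" by (rule V.span_add)
    then have "b \<in> V.span ?E" by (simp add: r_def)
    moreover have "B \<subseteq> V.span ?E"
      using E(2) V.span_mono[of E ?E] by auto
    moreover have "cinner x y = (if x = y then 1 else 0)" if "x \<in> ?E" "y \<in> ?E" for x y
    proof -
      have "cinner e (k *\<^sub>C r) = 0" "cinner (k *\<^sub>C r) e = 0" if "e \<in> E" for e
        using perp[OF that] perp'[OF that]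
        by (auto simp: cinner_scaleC_left cinner_scaleC_right)
      \<comment> \<open>A member of \<open>E\<close> is orthogonal to \<open>r\<close>, so this unit
        vector would be orthogonal to itself.\<close>
      moreover have "k *\<^sub>C r \<notin> E"
        using k(2) perp by (auto simp: cinner_scaleC_right)
      ultimately show ?thesis
        using that k(2) E(3) by auto
    qed
    ultimately show ?thesis
      using E(1) by (intro exI[of _ ?E]) auto
  qed
qed

lemma orthonormal_basis_exists: "\<exists>B :: 'h::fd_chilbert set. orthonormal_basis B"
proof -
  interpret V: vector_space "scaleC :: complex \<Rightarrow> 'h \<Rightarrow> 'h" by (rule vector_space_scaleC)
  obtain B :: "'h set" where B: "finite B" "\<And>x. \<exists>c. x = (\<Sum>b\<in>B. c b *\<^sub>C b)"
    using finite_dim by metis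
  obtain E where E: "finite E" "B \<subseteq> V.span E"
      "\<forall>x\<in>E. \<forall>y\<in>E. cinner x y = (if x = y then 1 else 0)"
    using gram_schmidt[OF B(1)] by blast
  have "x \<in> V.span E" for x
  proof -
    obtain c where "x = (\<Sum>b\<in>B. c b *\<^sub>C b)" using B(2) by blast
    then show ?thesis
      using E(2) by (auto intro!: V.span_sum V.span_scale)
  qed
  then show ?thesis
    using E by (auto simp: orthonormal_basis_def)
qed

text \<open>The very choice term inside \<open>Tr\<close>, so that the trace unfolds to a sum over
  this basis.\<close>

definition onb :: "'h::fd_chilbert set" where
  "onb = (SOME B. orthonormal_basis B)"

lemma orthonormal_basis_onb: "orthonormal_basis onb"
  unfolding onb_def using orthonormal_basis_exists by (rule someI_ex)

text \<open>Both sides are linear in \<open>x\<close> and agree on basis vectors, hence on the whole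
  span.\<close>

lemma onb_expansion: "x = (\<Sum>b\<in>onb. cinner b x *\<^sub>C b)" for x :: "'h::fd_chilbert"
proof -
  interpret V: vector_space "scaleC :: complex \<Rightarrow> 'h \<Rightarrow> 'h" by (rule vector_space_scaleC)
  have fin: "finite (onb :: 'h set)" and span: "V.span onb = (UNIV :: 'h set)"
    and on: "\<And>b e :: 'h. b \<in> onb \<Longrightarrow> e \<in> onb \<Longrightarrow> cinner b e = (if b = e then 1 else 0)"
    using orthonormal_basis_onb by (auto simp: orthonormal_basis_def)
  have "x \<in> V.span onb" by (simp add: span)
  then show ?thesis
  proof (induction rule: V.span_induct_alt)
    case base
    show ?case by simp
  next
    case (step c e y)
    have "(\<Sum>b\<in>onb. cinner b (c *\<^sub>C e + y) *\<^sub>C b)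
        = (\<Sum>b\<in>onb. (c * cinner b e) *\<^sub>C b) + (\<Sum>b\<in>onb. cinner b y *\<^sub>C b)"
      by (simp add: cinner_add_right cinner_scaleC_right scaleC_add_left sum.distrib)
    also have "(\<Sum>b\<in>onb. (c * cinner b e) *\<^sub>C b) = (\<Sum>b\<in>onb. if b = e then c *\<^sub>C e else 0)"
      by (rule sum.cong) (auto simp: on step)
    also have "\<dots> = c *\<^sub>C e"
      using fin step by simp
    finally show ?case using step by simp
  qed
qed

lemma parseval: "cinner x y = (\<Sum>b\<in>onb. cinner x b * cinner b y)" for x y :: "'h::fd_chilbert"
  by (subst onb_expansion[of y]) (simp add: cinner_sum_right cinner_scaleC_right mult.commute)


section \<open>Operators, adjoints and traces\<close>

lemma is_op_iff: "is_op A \<longleftrightarrow> (\<forall>x y. A (x + y) = A x + A y) \<and> (\<forall>c x. A (c *\<^sub>C x) = c *\<^sub>C A x)"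
  unfolding is_op_def Vector_Spaces.linear_iff by (auto simp: vector_space_scaleC)

lemma is_op_add: "is_op A \<Longrightarrow> A (x + y) = A x + A y"
  and is_op_scaleC: "is_op A \<Longrightarrow> A (c *\<^sub>C x) = c *\<^sub>C A x"
  by (auto simp: is_op_iff)

lemma is_op_zero: "is_op A \<Longrightarrow> A 0 = 0"
  using is_op_add[of A 0 0] by simp

lemma is_op_sum: "is_op A \<Longrightarrow> A (\<Sum>i\<in>I. g i) = (\<Sum>i\<in>I. A (g i))"
  by (induction I rule: infinite_finite_induct) (auto simp: is_op_zero is_op_add)

lemma is_op_plus: "is_op A \<Longrightarrow> is_op B \<Longrightarrow> is_op (\<lambda>x. A x + B x)"
  by (auto simp: is_op_iff scaleC_add_right)

lemma is_op_scale: "is_op A \<Longrightarrow> is_op (\<lambda>x. c *\<^sub>C A x)"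
  by (auto simp: is_op_iff scaleC_add_right scaleC_scaleC mult.commute)

lemma is_op_comp: "is_op A \<Longrightarrow> is_op B \<Longrightarrow> is_op (A \<circ> B)"
  by (auto simp: is_op_iff)

lemma is_op_sum_fun: "(\<And>i. i \<in> I \<Longrightarrow> is_op (A i)) \<Longrightarrow> is_op (\<lambda>x. \<Sum>i\<in>I. A i x)"
  by (auto simp: is_op_iff sum.distrib scaleC_sum_right)

section \<open>Adjoints\<close>

lemma adj_eqI:
  assumes "\<And>x y. cinner (B x) y = cinner x (A y)"
  shows "A\<^sup>\<dagger> = B"
  unfolding adj_def
proof (rule the_equality)
  show "\<forall>x y. cinner (B x) y = cinner x (A y)" using assms by blast
next
  fix C assume "\<forall>x y. cinner (C x) y = cinner x (A y)"
  then show "C = B" using assms by (intro ext cinner_ext) simp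
qed

text \<open>This is the existence of the adjoint. The coefficient of the adjoint vector at a basis
  element \<open>b\<close> can only be \<open>cinner (A b) x\<close>, and these coefficients define
  the witness \<open>B\<close>.\<close>

lemma cinner_adj_left:
  assumes "is_op A"
  shows "cinner ((A\<^sup>\<dagger>) x) y = cinner x (A y)"
proof -
  define B where "B x = (\<Sum>b\<in>onb. cinner (A b) x *\<^sub>C b)" for x
  have B: "cinner (B x) y = cinner x (A y)" for x y
  proof -
    have "cinner x (A y) = cinner x (A (\<Sum>b\<in>onb. cinner b y *\<^sub>C b))"
      by (simp flip: onb_expansion)
    also have "\<dots> = (\<Sum>b\<in>onb. cinner b y * cinner x (A b))"
      by (simp add: is_op_sum[OF assms] is_op_scaleC[OF assms] cinner_sum_right cinner_scaleC_right)
    also have "\<dots> = (\<Sum>b\<in>onb. cinner b y * cnj (cinner (A b) x))"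
      by (simp flip: cinner_commute)
    also have "\<dots> = cinner (B x) y"
      by (simp add: B_def cinner_sum_left cinner_scaleC_left mult.commute)
    finally show ?thesis ..
  qed
  then have "A\<^sup>\<dagger> = B" by (rule adj_eqI)
  with B show ?thesis by simp
qed

lemma cinner_adj_right: "is_op A \<Longrightarrow> cinner x ((A\<^sup>\<dagger>) y) = cinner (A x) y"
  by (metis cinner_adj_left cinner_commute)

lemma is_op_adj:
  assumes "is_op A"
  shows "is_op (A\<^sup>\<dagger>)"
  unfolding is_op_iff
  by (intro conjI allI; rule cinner_ext)
     (simp_all add: cinner_adj_left[OF assms] cinner_add_left cinner_scaleC_left)

lemma adj_adj: "is_op A \<Longrightarrow> A\<^sup>\<dagger>\<^sup>\<dagger> = A"
  by (rule adj_eqI) (simp add: cinner_adj_right)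

lemma adj_comp: "is_op A \<Longrightarrow> is_op B \<Longrightarrow> (A \<circ> B)\<^sup>\<dagger> = B\<^sup>\<dagger> \<circ> A\<^sup>\<dagger>"
  by (rule adj_eqI) (simp add: cinner_adj_left)

lemma adj_add: "is_op A \<Longrightarrow> is_op B \<Longrightarrow> (\<lambda>x. A x + B x)\<^sup>\<dagger> = (\<lambda>x. (A\<^sup>\<dagger>) x + (B\<^sup>\<dagger>) x)"
  by (rule adj_eqI) (simp add: cinner_adj_left cinner_add_left cinner_add_right)

lemma adj_scaleC: "is_op A \<Longrightarrow> (\<lambda>x. c *\<^sub>C A x)\<^sup>\<dagger> = (\<lambda>x. cnj c *\<^sub>C (A\<^sup>\<dagger>) x)"
  by (rule adj_eqI) (simp add: cinner_adj_left cinner_scaleC_left cinner_scaleC_right)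

lemma adj_sum:
  "(\<And>i. i \<in> I \<Longrightarrow> is_op (A i)) \<Longrightarrow> (\<lambda>x. \<Sum>i\<in>I. A i x)\<^sup>\<dagger> = (\<lambda>x. \<Sum>i\<in>I. (A i)\<^sup>\<dagger> x)"
  by (rule adj_eqI) (simp add: cinner_adj_left cinner_sum_left cinner_sum_right)

lemma observable_sum:
  assumes "\<And>i. i \<in> I \<Longrightarrow> observable (A i)"
  shows "observable (\<lambda>x. \<Sum>i\<in>I. complex_of_real (c i) *\<^sub>C A i x)"
  using assms by (simp add: observable_def is_op_sum_fun is_op_scale adj_sum adj_scaleC)

lemma observable_adj_comp_self: "is_op A \<Longrightarrow> observable (A\<^sup>\<dagger> \<circ> A)"
  by (simp add: observable_def is_op_comp is_op_adj adj_comp adj_adj)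

section \<open>The trace and its positivity on states\<close>

lemma Tr_onb: "Tr A = (\<Sum>b\<in>onb. cinner b (A b))"
  by (simp add: Tr_def onb_def)

text \<open>Inserting the basis between the two factors turns both traces into the same double sum,
  up to the order of summation.\<close>

lemma Tr_comp_commute:
  assumes "is_op A" "is_op B"
  shows "Tr (A \<circ> B) = Tr (B \<circ> A)"
proof -
  have *: "Tr (C \<circ> D) = (\<Sum>b\<in>onb. \<Sum>e\<in>onb. cinner b (C e) * cinner e (D b))"
    if "is_op C" for C D :: "'a \<Rightarrow> 'a"
  proof -
    have "cinner b (C (D b)) = (\<Sum>e\<in>onb. cinner b (C e) * cinner e (D b))" for b
      using parseval[of "(C\<^sup>\<dagger>) b" "D b"] by (simp add: cinner_adj_left that)
    then show ?thesis by (simp add: Tr_onb)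
  qed
  show ?thesis
    unfolding *[OF assms(1)] *[OF assms(2)]
    by (subst sum.swap) (simp add: mult.commute)
qed

lemma Tr_adj: "is_op A \<Longrightarrow> Tr (A\<^sup>\<dagger>) = cnj (Tr A)"
  by (simp add: Tr_onb cinner_adj_right flip: cinner_commute)

lemma Tr_comp_add: "is_op R \<Longrightarrow> Tr (R \<circ> (\<lambda>x. A x + B x)) = Tr (R \<circ> A) + Tr (R \<circ> B)"
  by (simp add: Tr_onb is_op_add cinner_add_right sum.distrib)

lemma Tr_comp_scaleC: "is_op R \<Longrightarrow> Tr (R \<circ> (\<lambda>x. c *\<^sub>C A x)) = c * Tr (R \<circ> A)"
  by (simp add: Tr_onb is_op_scaleC cinner_scaleC_right sum_distrib_left)

lemma Tr_comp_sum: "is_op R \<Longrightarrow> Tr (R \<circ> (\<lambda>x. \<Sum>i\<in>I. A i x)) = (\<Sum>i\<in>I. Tr (R \<circ> A i))"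
  by (simp add: Tr_onb is_op_sum cinner_sum_right) (rule sum.swap)

text \<open>For hermitian \<open>R\<close> the adjoint of \<open>R \<circ> A\<close> is the product
  of the adjoint of \<open>A\<close> with \<open>R\<close>, which has the required trace by
  cyclicity. This makes first-order terms cancel against their conjugates and the Fisher matrix
  symmetric.\<close>

lemma Tr_state_adj:
  assumes "state R" "is_op A"
  shows "Tr (R \<circ> A\<^sup>\<dagger>) = cnj (Tr (R \<circ> A))"
proof -
  have R: "is_op R" "R\<^sup>\<dagger> = R" using assms(1) by (auto simp: state_def)
  have "Tr (R \<circ> A\<^sup>\<dagger>) = Tr (A\<^sup>\<dagger> \<circ> R)"
    by (intro Tr_comp_commute is_op_adj R assms)
  also have "\<dots> = Tr ((R \<circ> A)\<^sup>\<dagger>)"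
    by (simp add: adj_comp R assms)
  also have "\<dots> = cnj (Tr (R \<circ> A))"
    by (intro Tr_adj is_op_comp R assms)
  finally show ?thesis .
qed

text \<open>Cyclicity moves \<open>A\<close> to the front, and the trace becomes a sum of
  expectations of \<open>R\<close> at the vectors \<open>(A\<^sup>\<dagger>) b\<close>. This is the
  positivity on which the whole bound rests.\<close>

lemma Tr_state_adj_comp_self_nonneg:
  assumes "state R" "is_op A"
  shows "0 \<le> Re (Tr (R \<circ> (A\<^sup>\<dagger> \<circ> A)))"
proof -
  have R: "is_op R" "\<And>x. 0 \<le> Re (cinner x (R x))" using assms(1) by (auto simp: state_def)
  have "Tr (R \<circ> (A\<^sup>\<dagger> \<circ> A)) = Tr ((R \<circ> A\<^sup>\<dagger>) \<circ> A)"
    by (simp add: comp_assoc)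
  also have "\<dots> = Tr (A \<circ> (R \<circ> A\<^sup>\<dagger>))"
    by (intro Tr_comp_commute is_op_comp is_op_adj R assms)
  also have "\<dots> = (\<Sum>b\<in>onb. cinner ((A\<^sup>\<dagger>) b) (R ((A\<^sup>\<dagger>) b)))"
    by (simp add: Tr_onb cinner_adj_left assms)
  finally show ?thesis
    using R(2) by (simp add: sum_nonneg)
qed


section \<open>The Moore-Penrose inverse of a symmetric matrix\<close>

text \<open>The condition under the description operator in \<open>pinv\<close>, named so that
  existence and uniqueness can be treated separately.\<close>

definition penrose_inverse :: "real^'n^'m \<Rightarrow> real^'m^'n \<Rightarrow> bool" where
  "penrose_inverse A B \<longleftrightarrow> A ** B ** A = A \<and> B ** A ** B = B \<and>
     transpose (A ** B) = A ** B \<and> transpose (B ** A) = B ** A"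

text \<open>\<open>A ** B\<close> and \<open>A ** C\<close> are both the orthogonal projection onto
  the range of \<open>A\<close>, and \<open>B ** A\<close> and \<open>C ** A\<close> are both the
  one onto the orthogonal complement of its kernel. Hence B = BAB = CAB = CAC = C.\<close>

lemma penrose_inverse_unique:
  assumes B: "penrose_inverse A B" and C: "penrose_inverse A C"
  shows "B = C"
proof -
  have "A ** B = (A ** C) ** (A ** B)"
    using C by (simp add: penrose_inverse_def matrix_mul_assoc)
  also have "\<dots> = transpose ((A ** B) ** (A ** C))"
    using B C by (simp add: penrose_inverse_def matrix_transpose_mul)
  also have "(A ** B) ** (A ** C) = A ** C"
    using B by (simp add: penrose_inverse_def matrix_mul_assoc)
  finally have AB: "A ** B = A ** C"
    using C by (simp add: penrose_inverse_def)
  have "B ** A = B ** (A ** C ** A)"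
    using C by (simp add: penrose_inverse_def)
  also have "\<dots> = (B ** A) ** (C ** A)"
    by (simp only: matrix_mul_assoc)
  also have "\<dots> = transpose ((C ** A) ** (B ** A))"
    using B C by (simp add: penrose_inverse_def matrix_transpose_mul)
  also have "(C ** A) ** (B ** A) = C ** (A ** B ** A)"
    by (simp only: matrix_mul_assoc)
  also have "\<dots> = C ** A"
    using B by (simp add: penrose_inverse_def)
  finally have BA: "B ** A = C ** A"
    using C by (simp add: penrose_inverse_def)
  have "B = B ** A ** B" using B by (simp add: penrose_inverse_def)
  also have "\<dots> = C ** (A ** B)" unfolding BA by (rule matrix_mul_assoc[symmetric])
  also have "\<dots> = C ** A ** C" unfolding AB by (rule matrix_mul_assoc)
  also have "\<dots> = C" using C by (simp add: penrose_inverse_def)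
  finally show ?thesis .
qed

lemma pinv_eqI: "penrose_inverse A B \<Longrightarrow> pinv A = B"
  unfolding pinv_def penrose_inverse_def[symmetric]
  by (rule the_equality) (auto dest: penrose_inverse_unique)

text \<open>For symmetric \<open>A\<close> the square has the same kernel as \<open>A\<close>,
  because |Ax|^2 = x . A(Ax). So \<open>A\<close> is injective on its range \<open>U\<close>, and by
  dimension it maps \<open>U\<close> onto itself. Every column of \<open>A\<close> is therefore of
  the form A(Az), and the vectors z form the columns of \<open>C\<close>.\<close>

lemma symmetric_factor_square:
  fixes A :: "real^'n^'n"
  assumes "transpose A = A"
  obtains C where "A = A ** A ** C"
proof -
  define U where "U = range ((*v) A)"
  have lin: "linear ((*v) A)" by (rule matrix_vector_mul_linear)
  have U: "subspace U"
    unfolding U_def by (intro linear_subspace_image lin subspace_UNIV)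
  have ker: "A *v x = 0" if "A *v (A *v x) = 0" for x
  proof -
    have "(A *v x) \<bullet> (A *v x) = x \<bullet> (A *v (A *v x))"
      by (metis assms dot_lmul_matrix inner_commute vector_transpose_matrix)
    then show ?thesis using that by simp
  qed
  have inj: "inj_on ((*v) A) U"
  proof (rule inj_onI)
    fix x y assume "x \<in> U" "y \<in> U" and eq: "A *v x = A *v y"
    then obtain z where z: "x - y = A *v z"
      using subspace_diff[OF U] unfolding U_def by blast
    have "A *v (x - y) = 0" using eq by (simp add: matrix_vector_mult_diff_distrib)
    then have "x - y = 0" using ker z by simp
    then show "x = y" by simp
  qed
  have "dim ((*v) A ` U) = dim U"
    using inj U by (intro dim_image_eq lin) (simp add: subspace_span span_eq_iff[THEN iffD2])
  moreover have "subspace ((*v) A ` U)" by (intro linear_subspace_image lin U)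
  moreover have "(*v) A ` U \<subseteq> U" by (auto simp: U_def)
  ultimately have img: "(*v) A ` U = U"
    using U by (intro subspace_dim_equal) auto
  have "\<exists>z. A *v axis i 1 = A *v (A *v z)" for i
  proof -
    have "A *v axis i 1 \<in> (*v) A ` U" unfolding img by (simp add: U_def)
    then show ?thesis by (auto simp: U_def)
  qed
  then obtain z where z: "\<And>i. A *v axis i 1 = A *v (A *v z i)" by metis
  define C where "C = (\<chi> k i. z i $ k)"
  have Cz: "C *v axis i 1 = z i" for i
    by (simp add: C_def matrix_vector_mult_basis column_def vec_eq_iff)
  have "column i A = column i (A ** A ** C)" for i
    using z[of i] by (simp add: Cz flip: matrix_vector_mult_basis matrix_vector_mul_assoc)
  then have "A = A ** A ** C" by (simp add: column_def vec_eq_iff)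
  then show ?thesis by (rule that)
qed

text \<open>With A = AAC, the matrix \<open>P\<close> = AC equals its transpose C'A and satisfies PA
  = A, so it is the orthogonal projection onto the range of \<open>A\<close>. Then \<open>B\<close>
  = PC = C'P is symmetric with AB = BA = P, and the Penrose equations follow.\<close>

lemma pinv_symmetric:
  fixes A :: "real^'n^'n"
  assumes A: "transpose A = A"
  shows "transpose (pinv A) = pinv A" and "pinv A ** A ** pinv A = pinv A"
proof -
  obtain C where C: "A = A ** A ** C" using symmetric_factor_square[OF A] by blast
  define P where "P = A ** C"
  define B where "B = P ** C"
  have C': "A = transpose C ** A ** A"
    using arg_cong[OF C, of transpose] by (simp add: matrix_transpose_mul A matrix_mul_assoc)
  have "P = transpose C ** A ** A ** C" unfolding P_def using C' by simp
  also have "\<dots> = transpose C ** A" by (metis C matrix_mul_assoc)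
  finally have P: "P = transpose C ** A" .
  have symP: "transpose P = P"
    by (metis A P P_def matrix_transpose_mul)
  have PA: "P ** A = A" using C' P by simp
  have AP: "A ** P = A" using C by (simp add: P_def matrix_mul_assoc)
  have PP: "P ** P = P" by (metis PA P_def matrix_mul_assoc)
  have B': "B = transpose C ** P"
    by (metis B_def P P_def matrix_mul_assoc)
  have AB: "A ** B = P" by (metis B_def AP P_def matrix_mul_assoc)
  have BA: "B ** A = P" by (metis B' P PA matrix_mul_assoc)
  have PB: "P ** B = B" by (simp add: B_def matrix_mul_assoc PP)
  have "penrose_inverse A B"
    by (simp add: penrose_inverse_def AB BA PA PB symP)
  then have pinv: "pinv A = B" by (rule pinv_eqI)
  have "transpose B = B"
    by (metis B' B_def matrix_transpose_mul symP)
  then show "transpose (pinv A) = pinv A" by (simp add: pinv)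
  show "pinv A ** A ** pinv A = pinv A" by (simp add: pinv BA PB)
qed


section \<open>The Cramer-Rao bound\<close>

text \<open>The summands are the outcome probabilities in the state \<open>R\<close>; completeness
  of the measurement reduces their sum to the trace of \<open>R\<close>.\<close>

lemma generalized_measurement_Tr:
  assumes "state R" "generalized_measurement S L"
  shows "(\<Sum>s\<in>S. Re (Tr (R \<circ> ((L s)\<^sup>\<dagger> \<circ> L s)))) = 1"
proof -
  have R: "is_op R" "Tr R = 1" using assms(1) by (auto simp: state_def)
  have "(\<Sum>s\<in>S. Tr (R \<circ> ((L s)\<^sup>\<dagger> \<circ> L s))) = Tr (R \<circ> (\<lambda>x. \<Sum>s\<in>S. ((L s)\<^sup>\<dagger> \<circ> L s) x))"
    by (rule Tr_comp_sum[symmetric]) (rule R)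
  also have "(\<lambda>x. \<Sum>s\<in>S. ((L s)\<^sup>\<dagger> \<circ> L s) x) = id"
    using assms(2) by (auto simp: generalized_measurement_def)
  also have "R \<circ> id = R" by simp
  finally show ?thesis using R by (simp del: comp_apply flip: Re_sum)
qed

text \<open>The bound is \<open>\<Sum>s\<in>S. Tr R K\<^sup>\<dagger> K \<ge> 0\<close> for \<open>K = L s \<circ> (e s + G)\<close> and
  \<open>e s = c - \<psi> s\<close>, where \<open>c\<close> is the mean of \<open>\<psi>\<close>.\<close>

lemma measurement_variance_bound:
  fixes L :: "'s \<Rightarrow> 'h::fd_chilbert \<Rightarrow> 'h" and \<psi> :: "'s \<Rightarrow> real"
  assumes R: "state R" and SL: "generalized_measurement S L"
    and G: "is_op G" and G0: "Tr (R \<circ> G) = 0"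
  defines "M \<equiv> \<lambda>s. (L s)\<^sup>\<dagger> \<circ> L s"
  defines "m \<equiv> \<lambda>s. Re (Tr (R \<circ> M s))"
  defines "X \<equiv> \<lambda>x. \<Sum>s\<in>S. complex_of_real (\<psi> s) *\<^sub>C M s x"
  shows "Re (Tr (R \<circ> (\<lambda>x. (G\<^sup>\<dagger> \<circ> X) x + (X \<circ> G) x))) - Re (Tr (R \<circ> (G\<^sup>\<dagger> \<circ> G)))
    \<le> (\<Sum>s\<in>S. (\<psi> s)\<^sup>2 * m s) - (\<Sum>s\<in>S. \<psi> s * m s)\<^sup>2"
proof -
  have Rop: "is_op R" using R by (auto simp: state_def)
  have L: "is_op (L s)" if "s \<in> S" for s using SL that by (auto simp: generalized_measurement_def)
  have sum_M: "(\<Sum>s\<in>S. M s x) = x" for x using SL by (auto simp: generalized_measurement_def M_def)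
  have G': "is_op (G\<^sup>\<dagger>)" by (rule is_op_adj[OF G])
  define c where "c = (\<Sum>s\<in>S. \<psi> s * m s)"
  \<comment> \<open>With this sign the cross terms add up to minus the trace involving
    \<open>X\<close>, once the part with the constant \<open>c\<close> has vanished by
    \<open>N1\<close>.\<close>
  define e where "e s = c - \<psi> s" for s
  define N where "N s = (\<lambda>x. (G\<^sup>\<dagger> \<circ> M s) x + (M s \<circ> G) x)" for s
  have K: "0 \<le> (e s)\<^sup>2 * m s + e s * Re (Tr (R \<circ> N s)) + Re (Tr (R \<circ> (G\<^sup>\<dagger> \<circ> (M s \<circ> G))))"
    if s: "s \<in> S" for s
  proof -
    \<comment> \<open>\<open>D\<close> is the operator e s + G, so \<open>L s \<circ> D\<close> is
      the operator whose positivity is used.\<close>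
    define D where "D = (\<lambda>x. complex_of_real (e s) *\<^sub>C x + G x)"
    have "is_op (\<lambda>x. x)" by (simp add: is_op_iff)
    then have D: "is_op D" unfolding D_def by (intro is_op_plus is_op_scale G)
    have adjD: "D\<^sup>\<dagger> = (\<lambda>x. complex_of_real (e s) *\<^sub>C x + (G\<^sup>\<dagger>) x)"
      unfolding D_def
      by (rule adj_eqI)
        (simp add: cinner_adj_left[OF G] cinner_add_left cinner_add_right cinner_scaleC_left cinner_scaleC_right)
    have M: "is_op (M s)" unfolding M_def by (intro is_op_comp is_op_adj L s)
    have "(L s \<circ> D)\<^sup>\<dagger> \<circ> (L s \<circ> D) = D\<^sup>\<dagger> \<circ> (M s \<circ> D)"
      by (simp add: adj_comp L[OF s] D M_def comp_assoc)
    also have "\<dots> = (\<lambda>x. (complex_of_real ((e s)\<^sup>2) *\<^sub>C M s x + complex_of_real (e s) *\<^sub>C N s x)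
        + (G\<^sup>\<dagger> \<circ> (M s \<circ> G)) x)"
      unfolding adjD
      by (rule ext) (simp add: D_def N_def is_op_add[OF M] is_op_scaleC[OF M] is_op_add[OF G'] is_op_scaleC[OF G']
        scaleC_add_right scaleC_scaleC power2_eq_square add_ac)
    finally have eq: "(L s \<circ> D)\<^sup>\<dagger> \<circ> (L s \<circ> D) = \<dots>" .
    have "0 \<le> Re (Tr (R \<circ> ((L s \<circ> D)\<^sup>\<dagger> \<circ> (L s \<circ> D))))"
      by (intro Tr_state_adj_comp_self_nonneg R is_op_comp L s D)
    then show ?thesis
      unfolding eq Tr_comp_add[OF Rop] Tr_comp_scaleC[OF Rop] by (simp add: m_def del: comp_apply)
  qed
  have GG: "(\<Sum>s\<in>S. Re (Tr (R \<circ> (G\<^sup>\<dagger> \<circ> (M s \<circ> G))))) = Re (Tr (R \<circ> (G\<^sup>\<dagger> \<circ> G)))"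
  proof -
    have "(\<Sum>s\<in>S. Tr (R \<circ> (G\<^sup>\<dagger> \<circ> (M s \<circ> G)))) = Tr (R \<circ> (\<lambda>x. \<Sum>s\<in>S. (G\<^sup>\<dagger> \<circ> (M s \<circ> G)) x))"
      by (rule Tr_comp_sum[symmetric]) (rule Rop)
    also have "(\<lambda>x. \<Sum>s\<in>S. (G\<^sup>\<dagger> \<circ> (M s \<circ> G)) x) = G\<^sup>\<dagger> \<circ> G"
      by (rule ext) (simp add: sum_M flip: is_op_sum[OF G'])
    finally show ?thesis by (simp del: comp_apply flip: Re_sum)
  qed
  \<comment> \<open>Stated for arbitrary weights because it serves twice: with constant weight 1,
    where \<open>Y\<close> is the identity by completeness, and with weights \<open>\<psi>\<close>,
    where \<open>Y\<close> is \<open>X\<close>.\<close>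
  have N: "(\<Sum>s\<in>S. a s * Re (Tr (R \<circ> N s))) = Re (Tr (R \<circ> (\<lambda>x. (G\<^sup>\<dagger> \<circ> Y) x + (Y \<circ> G) x)))"
    if Y: "Y = (\<lambda>x. \<Sum>s\<in>S. complex_of_real (a s) *\<^sub>C M s x)" for a Y
  proof -
    have "(\<lambda>x. (G\<^sup>\<dagger> \<circ> Y) x + (Y \<circ> G) x) = (\<lambda>x. \<Sum>s\<in>S. complex_of_real (a s) *\<^sub>C N s x)"
      by (rule ext)
        (simp add: Y N_def is_op_sum[OF G'] is_op_scaleC[OF G'] scaleC_add_right sum.distrib)
    then show ?thesis
      by (simp add: Tr_comp_sum[OF Rop] Tr_comp_scaleC[OF Rop])
  qed
  have N1: "(\<Sum>s\<in>S. Re (Tr (R \<circ> N s))) = 0"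
  proof -
    have "(\<Sum>s\<in>S. 1 * Re (Tr (R \<circ> N s))) = Re (Tr (R \<circ> (\<lambda>x. (G\<^sup>\<dagger> \<circ> id) x + (id \<circ> G) x)))"
      by (rule N) (simp add: scaleC_one sum_M fun_eq_iff)
    \<comment> \<open>What is left is Tr R G plus its complex conjugate, and \<open>G0\<close>
      removes both.\<close>
    also have "\<dots> = 0"
      unfolding Tr_comp_add[OF Rop] by (simp add: Tr_state_adj[OF R G] G0)
    finally show ?thesis by simp
  qed
  have m1: "(\<Sum>s\<in>S. m s) = 1"
    unfolding m_def M_def by (rule generalized_measurement_Tr[OF R SL])
  have "(\<Sum>s\<in>S. e s * Re (Tr (R \<circ> N s)))
      = c * (\<Sum>s\<in>S. Re (Tr (R \<circ> N s))) - (\<Sum>s\<in>S. \<psi> s * Re (Tr (R \<circ> N s)))"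
    by (simp add: e_def algebra_simps sum_subtractf sum_distrib_left)
  also have "\<dots> = - Re (Tr (R \<circ> (\<lambda>x. (G\<^sup>\<dagger> \<circ> X) x + (X \<circ> G) x)))"
    by (simp add: N1 N[of X \<psi>] X_def)
  finally have eN: "(\<Sum>s\<in>S. e s * Re (Tr (R \<circ> N s)))
      = - Re (Tr (R \<circ> (\<lambda>x. (G\<^sup>\<dagger> \<circ> X) x + (X \<circ> G) x)))" .
  have "(\<Sum>s\<in>S. (e s)\<^sup>2 * m s)
      = c\<^sup>2 * (\<Sum>s\<in>S. m s) - 2 * c * (\<Sum>s\<in>S. \<psi> s * m s) + (\<Sum>s\<in>S. (\<psi> s)\<^sup>2 * m s)"
    by (simp add: e_def power2_diff algebra_simps sum_subtractf sum.distrib sum_distrib_left sum_distrib_right)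
  also have "\<dots> = (\<Sum>s\<in>S. (\<psi> s)\<^sup>2 * m s) - c\<^sup>2"
    by (simp add: m1 power2_eq_square flip: c_def)
  finally have em: "(\<Sum>s\<in>S. (e s)\<^sup>2 * m s) = (\<Sum>s\<in>S. (\<psi> s)\<^sup>2 * m s) - c\<^sup>2" .
  have "0 \<le> (\<Sum>s\<in>S. (e s)\<^sup>2 * m s + e s * Re (Tr (R \<circ> N s)) + Re (Tr (R \<circ> (G\<^sup>\<dagger> \<circ> (M s \<circ> G)))))"
    using K by (intro sum_nonneg)
  also have "\<dots> = (\<Sum>s\<in>S. (\<psi> s)\<^sup>2 * m s) - c\<^sup>2
      - Re (Tr (R \<circ> (\<lambda>x. (G\<^sup>\<dagger> \<circ> X) x + (X \<circ> G) x))) + Re (Tr (R \<circ> (G\<^sup>\<dagger> \<circ> G)))"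
    by (simp add: sum.distrib em eN GG)
  finally show ?thesis by (simp add: c_def)
qed

text \<open>Two unbiased observables of the same function differ by a balanced one, on which
  condition (ii) for Fisher maps makes the symmetrized trace vanish. The observable chosen in
  \<open>crb_tensor\<close> may thus be traded for any convenient one.\<close>

lemma crb_tensor_eq:
  assumes F: "fisher_map \<Gamma> \<rho> F" and \<rho>: "parametric_family \<Gamma> \<rho>" and \<theta>: "\<theta> \<in> \<Gamma>"
    and X: "unbiased_observable \<Gamma> \<rho> X f"
  shows "crb_tensor \<Gamma> \<rho> f F \<theta> = (1/2) * Re (Tr (\<rho> \<theta> \<circ> (\<lambda>x. ((F \<theta>)\<^sup>\<dagger> \<circ> X) x + (X \<circ> F \<theta>) x)))"
proof -
  define Y where "Y = (SOME X. unbiased_observable \<Gamma> \<rho> X f)"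
  have Y: "unbiased_observable \<Gamma> \<rho> Y f"
    unfolding Y_def using X by (rule someI[of "\<lambda>X. unbiased_observable \<Gamma> \<rho> X f"])
  have \<rho>op: "is_op (\<rho> \<eta>)" if "\<eta> \<in> \<Gamma>" for \<eta>
    using \<rho> that by (auto simp: parametric_family_def state_def)
  have X': "is_op X" "X\<^sup>\<dagger> = X" and Y': "is_op Y" "Y\<^sup>\<dagger> = Y"
    using X Y by (auto simp: unbiased_observable_def observable_def)
  define Z where "Z = (\<lambda>x. Y x + (-1) *\<^sub>C X x)"
  have "balanced \<Gamma> \<rho> Z"
    unfolding balanced_def observable_def
  proof (intro conjI ballI)
    show "is_op Z" unfolding Z_def by (intro is_op_plus is_op_scale X' Y')
    show "Z\<^sup>\<dagger> = Z" unfolding Z_def by (simp add: adj_add adj_scaleC is_op_scale X' Y')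
  next
    fix \<eta> assume "\<eta> \<in> \<Gamma>"
    then show "Tr (\<rho> \<eta> \<circ> Z) = 0"
      using X Y unfolding Z_def
      by (simp only: Tr_comp_add[OF \<rho>op] Tr_comp_scaleC[OF \<rho>op]) (simp add: unbiased_observable_def)
  qed
  then have 0: "Tr (\<rho> \<theta> \<circ> (\<lambda>x. ((F \<theta>)\<^sup>\<dagger> \<circ> Z) x + (Z \<circ> F \<theta>) x)) = 0"
    using F \<theta> by (auto simp: fisher_map_def)
  have F': "is_op ((F \<theta>)\<^sup>\<dagger>)" using F \<theta> by (auto simp: fisher_map_def intro: is_op_adj)
  have "(\<lambda>x. ((F \<theta>)\<^sup>\<dagger> \<circ> Z) x + (Z \<circ> F \<theta>) x)
      = (\<lambda>x. (((F \<theta>)\<^sup>\<dagger> \<circ> Y) x + (Y \<circ> F \<theta>) x) + (-1) *\<^sub>C (((F \<theta>)\<^sup>\<dagger> \<circ> X) x + (X \<circ> F \<theta>) x))"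
    by (rule ext) (simp add: Z_def is_op_add[OF F'] is_op_scaleC[OF F'] scaleC_add_right add_ac)
  then have "Tr (\<rho> \<theta> \<circ> (\<lambda>x. ((F \<theta>)\<^sup>\<dagger> \<circ> Y) x + (Y \<circ> F \<theta>) x))
      = Tr (\<rho> \<theta> \<circ> (\<lambda>x. ((F \<theta>)\<^sup>\<dagger> \<circ> X) x + (X \<circ> F \<theta>) x))"
    using 0 by (simp add: Tr_comp_add[OF \<rho>op[OF \<theta>], of "\<lambda>x. ((F \<theta>)\<^sup>\<dagger> \<circ> Y) x + (Y \<circ> F \<theta>) x"]
        Tr_comp_scaleC[OF \<rho>op[OF \<theta>]] del: comp_apply)
  then show ?thesis by (simp add: crb_tensor_def Let_def flip: Y_def)
qed

text \<open>Supplies the concrete observable at which the tensor is evaluated. It is hermitian as a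
  real combination of hermitian operators.\<close>

lemma estimator_observable:
  assumes SL: "generalized_measurement S L" and \<rho>: "parametric_family \<Gamma> \<rho>"
    and \<phi>: "unbiased_estimator \<Gamma> \<rho> S L \<phi> f"
  shows "unbiased_observable \<Gamma> \<rho> (\<lambda>x. \<Sum>s\<in>S. complex_of_real (\<phi> s) *\<^sub>C ((L s)\<^sup>\<dagger> \<circ> L s) x) f"
  unfolding unbiased_observable_def
proof (intro conjI ballI)
  show "observable (\<lambda>x. \<Sum>s\<in>S. complex_of_real (\<phi> s) *\<^sub>C ((L s)\<^sup>\<dagger> \<circ> L s) x)"
    using SL by (intro observable_sum observable_adj_comp_self) (auto simp: generalized_measurement_def)
next
  fix \<eta> assume \<eta>: "\<eta> \<in> \<Gamma>"
  then have "is_op (\<rho> \<eta>)" using \<rho> by (auto simp: parametric_family_def state_def)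
  then show "Tr (\<rho> \<eta> \<circ> (\<lambda>x. \<Sum>s\<in>S. complex_of_real (\<phi> s) *\<^sub>C ((L s)\<^sup>\<dagger> \<circ> L s) x)) = complex_of_real (f \<eta>)"
    using \<phi> \<eta> by (simp add: Tr_comp_sum Tr_comp_scaleC unbiased_estimator_def comp_assoc del: comp_apply)
qed

section \<open>The Fisher, tensor and covariance matrices as forms in u and w\<close>

lemma Re_mult_real: "Re (complex_of_real r * z) = r * Re z"
  by simp

lemma inner_matrix_vector_sum:
  "x \<bullet> (A *v y) = (\<Sum>i\<in>UNIV. \<Sum>j\<in>UNIV. x $ i * y $ j * A $ i $ j)" for A :: "real^'n^'m"
  by (simp add: inner_vec_def matrix_vector_mult_def sum_distrib_left mult_ac)

text \<open>The (p,q) and (q,p) entries are real parts of complex conjugate traces.\<close>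

lemma transpose_fisher_matrix:
  assumes R: "state (\<rho> \<theta>)" and F: "\<And>j. is_op (F j \<theta>)"
  shows "transpose (fisher_matrix \<rho> F \<theta>) = fisher_matrix \<rho> F \<theta>"
proof -
  have "fisher_form \<rho> (F p) (F q) \<theta> = fisher_form \<rho> (F q) (F p) \<theta>" for p q
    using Tr_state_adj[OF R is_op_comp[OF is_op_adj[OF F[of q]] F[of p]]]
    by (simp add: fisher_form_def adj_comp is_op_adj F adj_adj comp_assoc)
  then show ?thesis
    by (subst vec_eq_iff, subst vec_eq_iff) (simp add: fisher_matrix_def transpose_def)
qed

text \<open>The Fisher matrix is the Gram matrix of the operators \<open>F j \<theta>\<close> for
  the form Re Tr \<rho> A\<dagger> B. As the weights are real, they pass unchanged through the
  adjoint.\<close>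

lemma fisher_matrix_quadratic_form:
  fixes w :: "real^'n"
  assumes R: "is_op (\<rho> \<theta>)" and F: "\<And>j. is_op (F j \<theta>)"
  defines "G \<equiv> \<lambda>x. \<Sum>j\<in>UNIV. complex_of_real (w $ j) *\<^sub>C F j \<theta> x"
  shows "Re (Tr (\<rho> \<theta> \<circ> (G\<^sup>\<dagger> \<circ> G))) = w \<bullet> (fisher_matrix \<rho> F \<theta> *v w)"
proof -
  have G': "G\<^sup>\<dagger> = (\<lambda>x. \<Sum>j\<in>UNIV. complex_of_real (w $ j) *\<^sub>C ((F j \<theta>)\<^sup>\<dagger>) x)"
    unfolding G_def by (simp add: adj_sum adj_scaleC is_op_scale F)
  have "G\<^sup>\<dagger> \<circ> G = (\<lambda>x. \<Sum>i\<in>UNIV. \<Sum>j\<in>UNIV.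
      complex_of_real (w $ i * w $ j) *\<^sub>C ((F i \<theta>)\<^sup>\<dagger> \<circ> F j \<theta>) x)"
    unfolding G'
    by (rule ext) (simp add: G_def is_op_sum is_op_scaleC is_op_adj F scaleC_sum_right scaleC_scaleC)
  then show ?thesis
    by (simp add: inner_matrix_vector_sum fisher_matrix_def fisher_form_def comp_assoc
        Tr_comp_sum[OF R] Tr_comp_scaleC[OF R] Re_mult_real del: of_real_mult comp_apply)
qed

text \<open>Bilinearity of the symmetrized trace in the Fisher operators and the observables; the
  factor 2 undoes the 1/2 in the tensor.\<close>

lemma crb_matrix_bilinear_form:
  fixes u :: "real^'m" and w :: "real^'n"
  assumes \<rho>: "parametric_family \<Gamma> \<rho>" and F: "\<And>j. fisher_map \<Gamma> \<rho> (F j)" and \<theta>: "\<theta> \<in> \<Gamma>"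
    and X: "\<And>i. unbiased_observable \<Gamma> \<rho> (X i) (f i)"
  defines "G \<equiv> \<lambda>x. \<Sum>j\<in>UNIV. complex_of_real (w $ j) *\<^sub>C F j \<theta> x"
  defines "Y \<equiv> \<lambda>x. \<Sum>i\<in>UNIV. complex_of_real (u $ i) *\<^sub>C X i x"
  shows "Re (Tr (\<rho> \<theta> \<circ> (\<lambda>x. (G\<^sup>\<dagger> \<circ> Y) x + (Y \<circ> G) x))) = 2 * (u \<bullet> (crb_matrix \<Gamma> \<rho> f F \<theta> *v w))"
proof -
  have R: "is_op (\<rho> \<theta>)" using \<rho> \<theta> by (auto simp: parametric_family_def state_def)
  have Fop: "is_op (F j \<theta>)" for j using F \<theta> by (auto simp: fisher_map_def)
  have Xop: "is_op (X i)" for i using X by (auto simp: unbiased_observable_def observable_def)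
  have G': "G\<^sup>\<dagger> = (\<lambda>x. \<Sum>j\<in>UNIV. complex_of_real (w $ j) *\<^sub>C ((F j \<theta>)\<^sup>\<dagger>) x)"
    unfolding G_def by (simp add: adj_sum adj_scaleC is_op_scale Fop)
  have "(G\<^sup>\<dagger> \<circ> Y) x = (\<Sum>i\<in>UNIV. \<Sum>j\<in>UNIV. complex_of_real (u $ i * w $ j) *\<^sub>C ((F j \<theta>)\<^sup>\<dagger> \<circ> X i) x)" for x
    unfolding G' by (subst sum.swap)
      (simp add: Y_def is_op_sum is_op_scaleC is_op_adj Fop scaleC_sum_right scaleC_scaleC mult.commute)
  moreover have "(Y \<circ> G) x = (\<Sum>i\<in>UNIV. \<Sum>j\<in>UNIV. complex_of_real (u $ i * w $ j) *\<^sub>C (X i \<circ> F j \<theta>) x)" for x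
    by (simp add: Y_def G_def is_op_sum is_op_scaleC Xop scaleC_sum_right scaleC_scaleC)
  ultimately have "(\<lambda>x. (G\<^sup>\<dagger> \<circ> Y) x + (Y \<circ> G) x) = (\<lambda>x. \<Sum>i\<in>UNIV. \<Sum>j\<in>UNIV.
      complex_of_real (u $ i * w $ j) *\<^sub>C (((F j \<theta>)\<^sup>\<dagger> \<circ> X i) x + (X i \<circ> F j \<theta>) x))"
    by (simp add: scaleC_add_right sum.distrib)
  then have "Re (Tr (\<rho> \<theta> \<circ> (\<lambda>x. (G\<^sup>\<dagger> \<circ> Y) x + (Y \<circ> G) x)))
      = (\<Sum>i\<in>UNIV. \<Sum>j\<in>UNIV. u $ i * w $ j *
          Re (Tr (\<rho> \<theta> \<circ> (\<lambda>x. ((F j \<theta>)\<^sup>\<dagger> \<circ> X i) x + (X i \<circ> F j \<theta>) x))))"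
    by (simp only: Tr_comp_sum[OF R] Tr_comp_scaleC[OF R] Re_sum Re_mult_real)
  also have "\<dots> = 2 * (u \<bullet> (crb_matrix \<Gamma> \<rho> f F \<theta> *v w))"
    by (simp add: inner_matrix_vector_sum crb_matrix_def crb_tensor_eq[OF F \<rho> \<theta> X] sum_distrib_left mult_ac
      del: comp_apply)
  finally show ?thesis .
qed

text \<open>By unbiasedness \<open>f i \<theta>\<close> is the mean of \<open>\<phi> i\<close> under
  the outcome probabilities \<open>m\<close>, so \<open>Cov\<close> is an ordinary covariance matrix
  and its quadratic form is the variance of the combination \<open>\<psi>\<close>.\<close>

lemma Cov_quadratic_form:
  fixes u :: "real^'m"
  assumes R: "is_op (\<rho> \<theta>)"
    and \<phi>: "\<And>i. unbiased_estimator \<Gamma> \<rho> S L (\<phi> i) (f i)" and \<theta>: "\<theta> \<in> \<Gamma>"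
  defines "m \<equiv> \<lambda>s. Re (Tr (\<rho> \<theta> \<circ> ((L s)\<^sup>\<dagger> \<circ> L s)))"
  defines "\<psi> \<equiv> \<lambda>s. \<Sum>i\<in>UNIV. u $ i * \<phi> i s"
  shows "u \<bullet> (Cov \<rho> S L \<phi> f \<theta> *v u) = (\<Sum>s\<in>S. (\<psi> s)\<^sup>2 * m s) - (\<Sum>s\<in>S. \<psi> s * m s)\<^sup>2"
proof -
  have f: "f i \<theta> = (\<Sum>s\<in>S. \<phi> i s * m s)" for i
  proof -
    have "complex_of_real (f i \<theta>) = (\<Sum>s\<in>S. complex_of_real (\<phi> i s) * Tr (\<rho> \<theta> \<circ> ((L s)\<^sup>\<dagger> \<circ> L s)))"
      using \<phi>[of i] \<theta> by (simp add: unbiased_estimator_def comp_assoc)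
    from arg_cong[OF this, of Re] show ?thesis by (simp add: m_def)
  qed
  have mean: "(\<Sum>s\<in>S. \<psi> s * m s) = (\<Sum>i\<in>UNIV. u $ i * f i \<theta>)"
    unfolding f \<psi>_def sum_distrib_left sum_distrib_right
    by (subst sum.swap) (simp add: mult_ac)
  have sq: "(\<Sum>s\<in>S. (\<psi> s)\<^sup>2 * m s)
      = (\<Sum>i\<in>UNIV. \<Sum>j\<in>UNIV. u $ i * u $ j * (\<Sum>s\<in>S. \<phi> i s * \<phi> j s * m s))"
  proof -
    have "(\<psi> s)\<^sup>2 * m s = (\<Sum>i\<in>UNIV. \<Sum>j\<in>UNIV. u $ i * u $ j * (\<phi> i s * \<phi> j s * m s))" for s
      unfolding \<psi>_def power2_eq_square sum_product
      by (simp add: sum_distrib_left mult_ac)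
    then show ?thesis
      by (simp add: sum_distrib_left sum.swap[of _ S])
  qed
  have "Cov \<rho> S L \<phi> f \<theta> $ i $ j = (\<Sum>s\<in>S. \<phi> i s * \<phi> j s * m s) - f i \<theta> * f j \<theta>" for i j
    by (simp add: Cov_def m_def Tr_comp_sum[OF R] Tr_comp_scaleC[OF R] Re_mult_real
      del: of_real_mult comp_apply)
  note entry = this
  have "u \<bullet> (Cov \<rho> S L \<phi> f \<theta> *v u)
      = (\<Sum>s\<in>S. (\<psi> s)\<^sup>2 * m s) - (\<Sum>i\<in>UNIV. u $ i * f i \<theta>) * (\<Sum>j\<in>UNIV. u $ j * f j \<theta>)"
    unfolding sq inner_matrix_vector_sum sum_product entry
    by (simp add: right_diff_distrib sum_subtractf mult_ac)
  then show ?thesis by (simp add: mean power2_eq_square)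
qed

theorem mainTheorem3:
  fixes \<Gamma> :: "'g set"
    and \<rho> :: "'g \<Rightarrow> 'h::fd_chilbert \<Rightarrow> 'h"
    and f :: "'m::finite \<Rightarrow> 'g \<Rightarrow> real"
    and S :: "'s set"
    and L :: "'s \<Rightarrow> 'h \<Rightarrow> 'h"
    and \<phi> :: "'m \<Rightarrow> 's \<Rightarrow> real"
    and F :: "'n::finite \<Rightarrow> 'g \<Rightarrow> 'h \<Rightarrow> 'h"
  assumes "parametric_family \<Gamma> \<rho>"
    and "generalized_measurement S L"
    and "\<And>i. unbiased_estimator \<Gamma> \<rho> S L (\<phi> i) (f i)"
    and "\<And>j. fisher_map \<Gamma> \<rho> (F j)"
    and "\<theta> \<in> \<Gamma>"
  shows "Cov \<rho> S L \<phi> f \<theta> \<succeq>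
    crb_matrix \<Gamma> \<rho> f F \<theta> ** pinv (fisher_matrix \<rho> F \<theta>) ** transpose (crb_matrix \<Gamma> \<rho> f F \<theta>)"
proof -
  note \<rho> = assms(1) and SL = assms(2) and \<phi> = assms(3) and F = assms(4) and \<theta> = assms(5)
  have R: "state (\<rho> \<theta>)" and Rop: "is_op (\<rho> \<theta>)"
    using \<rho> \<theta> by (auto simp: parametric_family_def state_def)
  have Fop: "is_op (F j \<theta>)" and F0: "Tr (\<rho> \<theta> \<circ> F j \<theta>) = 0" for j
    using F \<theta> by (auto simp: fisher_map_def)
  define C where "C = Cov \<rho> S L \<phi> f \<theta>"
  define \<Lambda> where "\<Lambda> = crb_matrix \<Gamma> \<rho> f F \<theta>"
  define J where "J = fisher_matrix \<rho> F \<theta>"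
  define P where "P = pinv J"
  have J: "transpose J = J" unfolding J_def by (rule transpose_fisher_matrix) (rule R Fop)+
  have P: "transpose P = P" "P ** J ** P = P" unfolding P_def by (rule pinv_symmetric[OF J])+
  have "transpose C = C"
    by (simp add: C_def Cov_def transpose_def vec_eq_iff mult.commute)
  moreover have "transpose (\<Lambda> ** P ** transpose \<Lambda>) = \<Lambda> ** P ** transpose \<Lambda>"
    by (simp add: matrix_transpose_mul P(1) matrix_mul_assoc)
  moreover have "transpose (A - B) = transpose A - transpose B" for A B :: "real^'m^'m"
    by (simp add: transpose_def vec_eq_iff)
  ultimately have sym: "transpose (C - \<Lambda> ** P ** transpose \<Lambda>) = C - \<Lambda> ** P ** transpose \<Lambda>"
    by simp
  have "0 \<le> u \<bullet> ((C - \<Lambda> ** P ** transpose \<Lambda>) *v u)" for u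
  proof -
    \<comment> \<open>The choice of \<open>w\<close> maximizing \<open>2 u \<bullet> \<Lambda> w - w \<bullet> J w\<close>.\<close>
    define w where "w = P *v (transpose \<Lambda> *v u)"
    define G where "G = (\<lambda>x. \<Sum>j\<in>UNIV. complex_of_real (w $ j) *\<^sub>C F j \<theta> x)"
    define \<psi> where "\<psi> s = (\<Sum>i\<in>UNIV. u $ i * \<phi> i s)" for s
    define X where "X i = (\<lambda>x. \<Sum>s\<in>S. complex_of_real (\<phi> i s) *\<^sub>C ((L s)\<^sup>\<dagger> \<circ> L s) x)" for i
    define Y where "Y = (\<lambda>x. \<Sum>s\<in>S. complex_of_real (\<psi> s) *\<^sub>C ((L s)\<^sup>\<dagger> \<circ> L s) x)"
    have X: "unbiased_observable \<Gamma> \<rho> (X i) (f i)" for i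
      unfolding X_def by (rule estimator_observable[OF SL \<rho> \<phi>])
    \<comment> \<open>The same observable seen as a sum over outcomes, as the variance bound
      requires, and as a combination of the estimators, as the tensor form requires.\<close>
    have Y: "Y = (\<lambda>x. \<Sum>i\<in>UNIV. complex_of_real (u $ i) *\<^sub>C X i x)"
      by (rule ext) (simp add: Y_def X_def \<psi>_def scaleC_sum_left scaleC_sum_right scaleC_scaleC sum.swap[of _ S])
    have G: "is_op G" unfolding G_def by (intro is_op_sum_fun is_op_scale Fop)
    have G0: "Tr (\<rho> \<theta> \<circ> G) = 0"
      unfolding G_def by (simp add: Tr_comp_sum[OF Rop] Tr_comp_scaleC[OF Rop] F0)
    have adj: "u \<bullet> (\<Lambda> *v v) = (transpose \<Lambda> *v u) \<bullet> v" for v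
      by (simp add: dot_lmul_matrix flip: vector_transpose_matrix)
    \<comment> \<open>Symmetry of \<open>P\<close> moves it onto \<open>J *v w\<close>, and P J P =
      P means that P J fixes \<open>w\<close>, which lies in the range of \<open>P\<close>.\<close>
    have wJw: "w \<bullet> (J *v w) = u \<bullet> (\<Lambda> *v w)"
    proof -
      have "w \<bullet> (J *v w) = (transpose \<Lambda> *v u) \<bullet> (P *v (J *v w))"
        unfolding w_def by (metis P(1) dot_lmul_matrix vector_transpose_matrix)
      also have "P *v (J *v w) = w"
        using P(2) by (simp add: w_def matrix_vector_mul_assoc matrix_mul_assoc)
      finally show ?thesis by (simp add: adj)
    qed
    \<comment> \<open>The variance bound for \<open>\<psi>\<close> and \<open>G\<close>, with its
      three ingredients rewritten as forms in \<open>u\<close> and \<open>w\<close>.\<close>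
    have "2 * (u \<bullet> (\<Lambda> *v w)) - w \<bullet> (J *v w) \<le> u \<bullet> (C *v u)"
      using measurement_variance_bound[OF R SL G G0, where \<psi> = \<psi>, folded Y_def]
        crb_matrix_bilinear_form[where X = X and F = F and f = f and w = w and u = u, OF \<rho> F \<theta> X, folded G_def Y \<Lambda>_def]
        fisher_matrix_quadratic_form[where \<rho> = \<rho> and \<theta> = \<theta> and F = F and w = w, OF Rop Fop, folded G_def J_def]
        Cov_quadratic_form[where \<rho> = \<rho> and \<theta> = \<theta> and u = u and f = f and \<phi> = \<phi>, OF Rop \<phi> \<theta>, folded \<psi>_def C_def]
      by simp
    then have "u \<bullet> (\<Lambda> *v w) \<le> u \<bullet> (C *v u)" by (simp add: wJw)
    moreover have "(\<Lambda> ** P ** transpose \<Lambda>) *v u = \<Lambda> *v w"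
      by (simp only: w_def matrix_vector_mul_assoc matrix_mul_assoc)
    ultimately show "0 \<le> u \<bullet> ((C - \<Lambda> ** P ** transpose \<Lambda>) *v u)"
      by (simp only: matrix_vector_mult_diff_rdistrib inner_diff_right diff_ge_0_iff_ge)
  qed
  with sym show ?thesis
    by (simp add: mat_ge_def C_def \<Lambda>_def P_def J_def)
qed

end
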